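(* Let $(a(n))_{n\ge 0}$ be the integer sequence defined by $$\sum_{n=0}^{\infty} a(n)\,x^n = \frac{2-2x}{1-2x-x^2},$$ equivalently $a(1)=2$, $a(2)=6$, and $a(n)=2a(n-1)+a(n-2)$ for all $n>2$. Then every member of the doubly-infinite family $$\{\,2^i\cdot 3^j \;:\; i\ge 3,\ j\ge 0\,\}$$ is a Companion-Pell pseudoprime; in other words, for all integers $i\ge 3$ and $j\ge 0$, $$\frac{a(2^i\cdot 3^j)-2}{2^i\, 3^j}$$ is an integer.
   Context: The sequence $(a(n))$ is the sequence of companion Pell numbers. A composite positive integer $n$ is called a Companion-Pell pseudoprime if $a(n)\equiv 2 \pmod n$ (a congruence satisfied by all primes $n$). *)

theory Defs
  imports
    "HOL-Computational_Algebra.Formal_Power_Series"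
    "HOL-Number_Theory.Cong"
begin

fun companion_pell :: "nat \<Rightarrow> int" where
  "companion_pell 0 = 2"
| "companion_pell (Suc 0) = 2"
| "companion_pell (Suc (Suc n)) = 2 * companion_pell (Suc n) + companion_pell n"

lemma companion_pell_1: "companion_pell 1 = 2"
  and companion_pell_2: "companion_pell 2 = 6"
  by (simp_all add: numeral_2_eq_2)

lemma companion_pell_rec:
  assumes "n > 2"
  shows "companion_pell n = 2 * companion_pell (n - 1) + companion_pell (n - 2)"
proof -
  obtain m where "n = Suc (Suc m)"
    using assms by (metis One_nat_def Suc_1 less_imp_Suc_add plus_1_eq_Suc add_Suc)
  then show ?thesis by simp
qed

text \<open>Division of formal power series needs coefficients in a field, hence \<^typ>\<open>rat\<close>.\<close>

definition companion_pell_gf :: "rat fps" where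
  "companion_pell_gf = (2 - 2 * fps_X) / (1 - 2 * fps_X - fps_X ^ 2)"

definition companion_pell_pseudoprime :: "nat \<Rightarrow> bool" where
  "companion_pell_pseudoprime n \<longleftrightarrow>
     n > 1 \<and> \<not> prime n \<and> [companion_pell n = 2] (mod int n)"

end

theory Submission
  imports Defs
begin

text \<open>For even \<open>n\<close> the multiplication formulas for companion Pell numbers give
  \<open>a(2n) - 2 = (a(n) - 2)(a(n) + 2)\<close> and \<open>a(3n) - 2 = (a(n) - 2)(a(n) + 1)\<^sup>2\<close>.
  All terms are even, so doubling gains a factor 2. Starting from
  \<open>a(8) - 2 = 1152 = 2\<^sup>7 \<cdot> 3\<^sup>2\<close>, the extra factor 3 yields \<open>a(n) \<equiv> 2 (mod 3)\<close>, hence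
  tripling gains a factor 3, and both steps preserve the extra factor.\<close>

text \<open>Clearing the denominator turns the claim into a comparison of coefficients; the constant
  term 1 of \<open>?D\<close> makes it nonzero, so it may be cancelled.\<close>

lemma companion_pell_gf_eq: "Abs_fps (\<lambda>n. of_int (companion_pell n)) = companion_pell_gf"
proof -
  let ?A = "Abs_fps (\<lambda>n. of_int (companion_pell n)) :: rat fps"
  let ?D = "1 - 2 * fps_X - fps_X ^ 2 :: rat fps"
  have D0: "fps_nth ?D 0 \<noteq> 0"
    by simp
  have "?A * ?D = 2 - 2 * fps_X"
  proof (rule fps_ext)
    fix n
    have expand: "?A * ?D = ?A - 2 * (fps_X * ?A) - fps_X * (fps_X * ?A)"
      by (simp add: algebra_simps power2_eq_square)
    \<comment> \<open>The initial values produce the numerator; from index 2 on, the recurrence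
      makes the coefficients vanish.\<close>
    consider "n = 0" | "n = 1" | m where "n = Suc (Suc m)"
      by (metis One_nat_def not0_implies_Suc)
    then show "fps_nth (?A * ?D) n = fps_nth (2 - 2 * fps_X) n"
      unfolding expand
      by cases (simp_all add: numeral_fps_const)
  qed
  moreover have "?D \<noteq> 0"
    using D0 by force
  ultimately show ?thesis
    unfolding companion_pell_gf_def by (metis nonzero_mult_div_cancel_right)
qed

text \<open>The form x^2 - 2xy - y^2 changes sign under the recurrence step (x, y) to (2x + y, x),
  and its initial value is -8.\<close>

lemma companion_pell_quadratic_form:
  "companion_pell (Suc n) ^ 2 - 2 * companion_pell (Suc n) * companion_pell n
     - companion_pell n ^ 2 = - 8 * (- 1) ^ n"
proof (induction n)
  case (Suc n)
  then show ?case
    by (simp add: power2_eq_square algebra_simps)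
qed simp

text \<open>The recurrence links even and odd indices, so both are proved in one induction. The
  quadratic form supplies the square of \<open>companion_pell (Suc n)\<close>.\<close>

lemma companion_pell_double_aux:
  "companion_pell (2 * n) = companion_pell n ^ 2 - 2 * (- 1) ^ n \<and>
   companion_pell (Suc (2 * n)) = companion_pell (Suc n) * companion_pell n - 2 * (- 1) ^ n"
proof (induction n)
  case (Suc n)
  then show ?case
    using companion_pell_quadratic_form[of n]
    by (simp add: power2_eq_square algebra_simps)
qed simp

text \<open>For fixed \<open>n\<close> both sides satisfy the same recurrence in \<open>m\<close>;
  the cases 0 and 1 are the two doubling formulas.\<close>

lemma companion_pell_add_double:
  "companion_pell (m + 2 * n) =
     companion_pell (m + n) * companion_pell n - (- 1) ^ n * companion_pell m"
proof (induction m rule: companion_pell.induct)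
  case (3 m)
  then show ?case
    by (simp add: algebra_simps)
qed (use companion_pell_double_aux[of n] in \<open>simp_all add: power2_eq_square\<close>)

lemma companion_pell_double:
  "companion_pell (2 * n) = companion_pell n ^ 2 - 2 * (- 1) ^ n"
  using companion_pell_double_aux by blast

lemma companion_pell_triple:
  "companion_pell (3 * n) = companion_pell n ^ 3 - 3 * (- 1) ^ n * companion_pell n"
proof -
  have "companion_pell (3 * n) =
      companion_pell (2 * n) * companion_pell n - (- 1) ^ n * companion_pell n"
    using companion_pell_add_double[of n n] by (simp add: mult_2 [symmetric] add_mult_distrib)
  then show ?thesis
    unfolding companion_pell_double by (simp add: power2_eq_square power3_eq_cube algebra_simps)
qed

lemma even_companion_pell: "even (companion_pell n)"
  by (induction n rule: companion_pell.induct) auto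

lemma companion_pell_double_minus_2:
  assumes "even n"
  shows "companion_pell (2 * n) - 2 = (companion_pell n - 2) * (companion_pell n + 2)"
  unfolding companion_pell_double using assms by (simp add: power2_eq_square algebra_simps)

lemma companion_pell_triple_minus_2:
  assumes "even n"
  shows "companion_pell (3 * n) - 2 = (companion_pell n - 2) * (companion_pell n + 1) ^ 2"
  unfolding companion_pell_triple using assms by (simp add: power2_eq_square power3_eq_cube algebra_simps)

lemma companion_pell_double_dvd:
  assumes "even n" and "d dvd companion_pell n - 2"
  shows "2 * d dvd companion_pell (2 * n) - 2"
  using mult_dvd_mono[OF assms(2), of 2 "companion_pell n + 2"] even_companion_pell[of n]
  unfolding companion_pell_double_minus_2[OF assms(1)] by (simp add: mult.commute)

lemma companion_pell_triple_dvd: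
  assumes "even n" and "3 * d dvd companion_pell n - 2"
  shows "3 * (3 * d) dvd companion_pell (3 * n) - 2"
proof -
  \<comment> \<open>Adding 3 turns the known factor a(n) - 2 into a(n) + 1, whose square is the
    cofactor.\<close>
  have "3 dvd (companion_pell n - 2) + 3"
    using assms(2) by (intro dvd_add) (auto intro: dvd_mult_left)
  then have "3 dvd (companion_pell n + 1) ^ 2"
    by (simp add: power2_eq_square add.commute)
  from mult_dvd_mono[OF assms(2) this] show ?thesis
    unfolding companion_pell_triple_minus_2[OF assms(1)] by (simp add: ac_simps)
qed

text \<open>The leading 3 strengthens the claim so that the induction on \<open>j\<close> goes
  through. The inner induction on \<open>k\<close> carries it along inside the divisor
  \<open>d\<close>. It is absent at index 4, where a(4) - 2 = 32.\<close>

lemma companion_pell_2_power_3_power_dvd: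
  "3 * (2 ^ (k + 3) * 3 ^ j) dvd companion_pell (2 ^ (k + 3) * 3 ^ j) - 2"
proof (induction j)
  case 0
  show ?case
  proof (induction k)
    case 0
    have "companion_pell 8 = 1154"
      by (simp add: eval_nat_numeral)
    then show ?case
      by simp
  next
    case (Suc k)
    then show ?case
      using companion_pell_double_dvd[of "2 ^ (k + 3)" "3 * 2 ^ (k + 3)"]
      by (simp add: mult.left_commute power_add)
  qed
next
  case (Suc j)
  then show ?case
    using companion_pell_triple_dvd[of "2 ^ (k + 3) * 3 ^ j" "2 ^ (k + 3) * 3 ^ j"]
    by (simp add: mult.left_commute)
qed

lemma companion_pell_2_power_3_power_dvd':
  assumes "i \<ge> 3"
  shows "2 ^ i * 3 ^ j dvd companion_pell (2 ^ i * 3 ^ j) - 2"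
  using companion_pell_2_power_3_power_dvd[of "i - 3" j] assms dvd_mult_right by fastforce

lemma companion_pell_pseudoprime_2_power_3_power:
  assumes "i \<ge> 3"
  shows "companion_pell_pseudoprime (2 ^ i * 3 ^ j)"
proof -
  define n :: nat where "n = 2 ^ i * 3 ^ j"
  \<comment> \<open>The bound 8 separates \<open>n\<close> from 2, the only even prime.\<close>
  have "(2 :: nat) ^ 3 dvd n"
    unfolding n_def using assms by (intro dvd_mult2 le_imp_power_dvd)
  moreover have "n > 0"
    by (simp add: n_def)
  ultimately have "n \<ge> 8"
    by (auto dest: dvd_imp_le)
  have "2 dvd n"
    unfolding n_def using assms by simp
  with \<open>n \<ge> 8\<close> have "\<not> prime n"
    using primes_dvd_imp_eq[OF two_is_prime_nat, of n] by linarith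
  moreover have "int n dvd companion_pell n - 2"
    using companion_pell_2_power_3_power_dvd'[OF assms, of j] by (simp add: n_def)
  ultimately show ?thesis
    using \<open>n \<ge> 8\<close> unfolding n_def [symmetric]
    by (simp add: companion_pell_pseudoprime_def cong_iff_dvd_diff)
qed

theorem theorem1:
  "Abs_fps (\<lambda>n. of_int (companion_pell n)) = companion_pell_gf
   \<and> {2 ^ i * 3 ^ j | (i :: nat) (j :: nat). i \<ge> 3} \<subseteq> {n :: nat. companion_pell_pseudoprime n}
   \<and> (\<forall>(i :: nat) (j :: nat). i \<ge> 3 \<longrightarrow>
        (of_int (companion_pell (2 ^ i * 3 ^ j)) - 2) / (2 ^ i * 3 ^ j) \<in> (\<int> :: rat set))"
proof (intro conjI allI impI)
  show "Abs_fps (\<lambda>n. of_int (companion_pell n)) = companion_pell_gf"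
    by (rule companion_pell_gf_eq)
  show "{2 ^ i * 3 ^ j | (i :: nat) (j :: nat). i \<ge> 3} \<subseteq> {n :: nat. companion_pell_pseudoprime n}"
    using companion_pell_pseudoprime_2_power_3_power by auto
next
  fix i j :: nat
  assume "i \<ge> 3"
  then obtain k where "companion_pell (2 ^ i * 3 ^ j) - 2 = 2 ^ i * 3 ^ j * k"
    using companion_pell_2_power_3_power_dvd'[of i j] by auto
  from arg_cong[OF this, of rat_of_int]
  have "(of_int (companion_pell (2 ^ i * 3 ^ j)) - 2 :: rat) = 2 ^ i * 3 ^ j * of_int k"
    by simp
  then show "(of_int (companion_pell (2 ^ i * 3 ^ j)) - 2) / (2 ^ i * 3 ^ j) \<in> (\<int> :: rat set)"
    by simp
qed

end
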